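(* Let $R$ be a commutative ring with unity and let $(A,\alpha),(B,\beta)$ be objects of $\operatorname{End}(\mathrm{FRel}(R))$ such that $\alpha$ and $\beta$ are bijections. If $(A,\alpha)$ and $(B,\beta)$ are isomorphic in the Szymczak category $\operatorname{Szym}(\mathrm{FRel}(R))$, then they are isomorphic in $\operatorname{End}(\mathrm{FRel}(R))$.
   Context: Linear relations. For $R$-modules $M,N$, a linear relation $\varphi\colon M\multimap N$ is a submodule $\varphi\subseteq M\oplus N$. For $\varphi\colon M\multimap N$ and $\psi\colon N\multimap P$, $\psi\circ\varphi=\{(m,p)\in M\oplus P:\exists n\in N,\ (m,n)\in\varphi,\ (n,p)\in\psi\}$. A linear relation $\alpha\colon A\multimap A$ is a bijection if it is the graph of a bijective map $A\to A$ (equivalently, of a module automorphism). For $\alpha\colon A\multimap A$, $\alpha^0=\operatorname{id}_A$ and $\alpha^k$ is the $k$-fold composition for $k\in\mathbb N$ ($0\in\mathbb N$). Categories. $\mathrm{FRel}(R)$ has $R$-modules of finite length (both Noetherian and Artinian) as objects and linear relations as morphisms, with the composition of $\varphi\colon M\multimap N$ and $\psi\colon N\multimap P$ given by $\psi\circ\varphi=\{(m,p)\in M\oplus P:\exists n\in N,\ (m,n)\in\varphi,\ (n,p)\in\psi\}$. For a category $\mathcal C$, $\operatorname{End}(\mathcal C)$ has as objects pairs $(A,\alpha)$ with $A\in\mathcal C$ and $\alpha\colon A\to A$ a morphism of $\mathcal C$; morphisms $(A,\alpha)\to(B,\beta)$ are morphisms $\varphi\colon A\to B$ of $\mathcal C$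 with $\varphi\circ\alpha=\beta\circ\varphi$. The Szymczak category $\operatorname{Szym}(\mathcal C)$ has the same objects as $\operatorname{End}(\mathcal C)$; its morphisms $(A,\alpha)\to(B,\beta)$ are equivalence classes $[\varphi,n]$ of pairs $(\varphi,n)$, with $\varphi\colon(A,\alpha)\to(B,\beta)$ a morphism of $\operatorname{End}(\mathcal C)$ and $n\in\mathbb N$, under $(\varphi,n)\equiv(\psi,m)\iff\exists k\in\mathbb N:\ \varphi\circ\alpha^{m+k}=\psi\circ\alpha^{n+k}$. Composition is $[\psi,m]\circ[\varphi,n]=[\psi\circ\varphi,m+n]$, and the identity of $(A,\alpha)$ is $[\operatorname{id}_A,0]$. *)

theory Defs
  imports "HOL-Algebra.Module"
begin

section \<open>Categories\<close>

text \<open>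
  Hom-sets need not be disjoint, so composition and identities take the objects as arguments:
  \<open>Comp C X Y Z g f\<close> is the composite of \<open>f\<close> from \<open>X\<close> to \<open>Y\<close> followed by \<open>g\<close> from \<open>Y\<close> to \<open>Z\<close>.
\<close>

record ('o, 'm) category =
  Obj :: "'o set"
  Hom :: "'o \<Rightarrow> 'o \<Rightarrow> 'm set"
  Comp :: "'o \<Rightarrow> 'o \<Rightarrow> 'o \<Rightarrow> 'm \<Rightarrow> 'm \<Rightarrow> 'm"
  Ident :: "'o \<Rightarrow> 'm"

locale category =
  fixes C :: "('o, 'm) category"
  assumes Ident_Hom: "X \<in> Obj C \<Longrightarrow> Ident C X \<in> Hom C X X"
    and Comp_Hom: "\<lbrakk>X \<in> Obj C; Y \<in> Obj C; Z \<in> Obj C; f \<in> Hom C X Y; g \<in> Hom C Y Z\<rbrakk>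
      \<Longrightarrow> Comp C X Y Z g f \<in> Hom C X Z"
    and Comp_Ident_right: "\<lbrakk>X \<in> Obj C; Y \<in> Obj C; f \<in> Hom C X Y\<rbrakk>
      \<Longrightarrow> Comp C X X Y f (Ident C X) = f"
    and Comp_Ident_left: "\<lbrakk>X \<in> Obj C; Y \<in> Obj C; f \<in> Hom C X Y\<rbrakk>
      \<Longrightarrow> Comp C X Y Y (Ident C Y) f = f"
    and Comp_assoc: "\<lbrakk>W \<in> Obj C; X \<in> Obj C; Y \<in> Obj C; Z \<in> Obj C;
        f \<in> Hom C W X; g \<in> Hom C X Y; h \<in> Hom C Y Z\<rbrakk>
      \<Longrightarrow> Comp C W Y Z h (Comp C W X Y g f) = Comp C W X Z (Comp C X Y Z h g) f"

definition isomorphic_in :: "('o, 'm) category \<Rightarrow> 'o \<Rightarrow> 'o \<Rightarrow> bool" where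
  "isomorphic_in C X Y \<longleftrightarrow> X \<in> Obj C \<and> Y \<in> Obj C \<and>
     (\<exists>f \<in> Hom C X Y. \<exists>g \<in> Hom C Y X.
        Comp C X Y X g f = Ident C X \<and> Comp C Y X Y f g = Ident C Y)"

primrec endo_pow :: "('o, 'm) category \<Rightarrow> 'o \<Rightarrow> 'm \<Rightarrow> nat \<Rightarrow> 'm" where
  "endo_pow C X a 0 = Ident C X"
| "endo_pow C X a (Suc k) = Comp C X X X a (endo_pow C X a k)"


section \<open>The category of endomorphisms and the Szymczak category\<close>

definition End_Hom :: "('o, 'm) category \<Rightarrow> 'o \<times> 'm \<Rightarrow> 'o \<times> 'm \<Rightarrow> 'm set" where
  "End_Hom C = (\<lambda>(A, \<alpha>) (B, \<beta>). {\<phi> \<in> Hom C A B. Comp C A A B \<phi> \<alpha> = Comp C A B B \<beta> \<phi>})"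

definition End_cat :: "('o, 'm) category \<Rightarrow> ('o \<times> 'm, 'm) category" where
  "End_cat C =
    \<lparr>Obj = {(A, \<alpha>). A \<in> Obj C \<and> \<alpha> \<in> Hom C A A},
     Hom = End_Hom C,
     Comp = (\<lambda>X Y Z. Comp C (fst X) (fst Y) (fst Z)),
     Ident = (\<lambda>X. Ident C (fst X))\<rparr>"

definition szym_rel ::
    "('o, 'm) category \<Rightarrow> 'o \<times> 'm \<Rightarrow> 'o \<times> 'm \<Rightarrow> (('m \<times> nat) \<times> ('m \<times> nat)) set" where
  "szym_rel C = (\<lambda>(A, \<alpha>) (B, \<beta>).
     {((\<phi>, n), (\<psi>, m)). \<phi> \<in> Hom (End_cat C) (A, \<alpha>) (B, \<beta>) \<and> \<psi> \<in> Hom (End_cat C) (A, \<alpha>) (B, \<beta>) \<and>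
        (\<exists>k. Comp C A A B \<phi> (endo_pow C A \<alpha> (m + k)) = Comp C A A B \<psi> (endo_pow C A \<alpha> (n + k)))})"

definition szym_class :: "('o, 'm) category \<Rightarrow> 'o \<times> 'm \<Rightarrow> 'o \<times> 'm \<Rightarrow> 'm \<Rightarrow> nat \<Rightarrow> ('m \<times> nat) set" where
  "szym_class C X Y \<phi> n = szym_rel C X Y `` {(\<phi>, n)}"

text \<open>
  In \<open>Comp\<close> below the union over all representatives is the class of any one of them, the
  operation on representatives being compatible with \<open>szym_rel\<close> (see \<open>Szym_Comp_class\<close>).
\<close>

definition Szym :: "('o, 'm) category \<Rightarrow> ('o \<times> 'm, ('m \<times> nat) set) category" where
  "Szym C =
    \<lparr>Obj = Obj (End_cat C),
     Hom = (\<lambda>X Y. (Hom (End_cat C) X Y \<times> UNIV) // szym_rel C X Y),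
     Comp = (\<lambda>X Y Z G F. \<Union>(\<psi>, m) \<in> G. \<Union>(\<phi>, n) \<in> F.
                 szym_class C X Z (Comp (End_cat C) X Y Z \<psi> \<phi>) (m + n)),
     Ident = (\<lambda>X. szym_class C X X (Ident (End_cat C) X) 0)\<rparr>"


section \<open>Modules of finite length and linear relations\<close>

definition dir_sum ::
    "('a, 'b, 'm) module_scheme \<Rightarrow> ('a, 'c, 'n) module_scheme \<Rightarrow> ('a, 'b \<times> 'c) module" where
  "dir_sum M N =
    \<lparr>carrier = carrier M \<times> carrier N,
     mult = (\<lambda>(x, y) (x', y'). (x \<otimes>\<^bsub>M\<^esub> x', y \<otimes>\<^bsub>N\<^esub> y')),
     one = (\<one>\<^bsub>M\<^esub>, \<one>\<^bsub>N\<^esub>),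
     zero = (\<zero>\<^bsub>M\<^esub>, \<zero>\<^bsub>N\<^esub>),
     add = (\<lambda>(x, y) (x', y'). (x \<oplus>\<^bsub>M\<^esub> x', y \<oplus>\<^bsub>N\<^esub> y')),
     smult = (\<lambda>r (x, y). (r \<odot>\<^bsub>M\<^esub> x, r \<odot>\<^bsub>N\<^esub> y))\<rparr>"
  \<comment> \<open>\<open>mult\<close> and \<open>one\<close> are inherited from the ring record and play no role for modules.\<close>

definition noetherian_module :: "('a, 'r) ring_scheme \<Rightarrow> ('a, 'b, 'm) module_scheme \<Rightarrow> bool" where
  "noetherian_module R M \<longleftrightarrow> module R M \<and>
     (\<forall>S :: nat \<Rightarrow> 'b set. (\<forall>i. submodule (S i) R M) \<and> (\<forall>i. S i \<subseteq> S (Suc i))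
        \<longrightarrow> (\<exists>n. \<forall>i\<ge>n. S i = S n))"

definition artinian_module :: "('a, 'r) ring_scheme \<Rightarrow> ('a, 'b, 'm) module_scheme \<Rightarrow> bool" where
  "artinian_module R M \<longleftrightarrow> module R M \<and>
     (\<forall>S :: nat \<Rightarrow> 'b set. (\<forall>i. submodule (S i) R M) \<and> (\<forall>i. S (Suc i) \<subseteq> S i)
        \<longrightarrow> (\<exists>n. \<forall>i\<ge>n. S i = S n))"

definition finite_length :: "('a, 'r) ring_scheme \<Rightarrow> ('a, 'b, 'm) module_scheme \<Rightarrow> bool" where
  "finite_length R M \<longleftrightarrow> noetherian_module R M \<and> artinian_module R M"

definition linear_relation ::
    "('a, 'r) ring_scheme \<Rightarrow> ('a, 'b, 'm) module_scheme \<Rightarrow> ('a, 'c, 'n) module_scheme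
      \<Rightarrow> ('b \<times> 'c) set \<Rightarrow> bool" where
  "linear_relation R M N \<phi> \<longleftrightarrow> submodule \<phi> R (dir_sum M N)"

definition bijection_rel :: "('a, 'b, 'm) module_scheme \<Rightarrow> ('b \<times> 'b) set \<Rightarrow> bool" where
  "bijection_rel A \<alpha> \<longleftrightarrow>
     (\<exists>f. bij_betw f (carrier A) (carrier A) \<and> \<alpha> = {(x, f x) | x. x \<in> carrier A})"

text \<open>
  The type \<open>'b\<close> serves as the universe: the objects are the finite length modules carried by
  arbitrary subsets of \<open>'b\<close>. Modules given on different types \<open>'c\<close> and \<open>'d\<close> can be transported to
  the common type \<open>'c + 'd\<close>. Note that \<open>\<phi> O \<psi>\<close> relates \<open>m\<close> to \<open>p\<close> iff
  \<open>(m, n) \<in> \<phi>\<close> and \<open>(n, p) \<in> \<psi>\<close> for some \<open>n\<close>.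
\<close>

definition FRel :: "('a, 'r) ring_scheme \<Rightarrow> (('a, 'b) module, ('b \<times> 'b) set) category" where
  "FRel R =
    \<lparr>Obj = {M. module R M \<and> finite_length R M},
     Hom = (\<lambda>M N. {\<phi>. linear_relation R M N \<phi>}),
     Comp = (\<lambda>M N P \<psi> \<phi>. \<phi> O \<psi>),
     Ident = (\<lambda>M. Id_on (carrier M))\<rparr>"


section \<open>The constructions yield categories\<close>

lemma dir_sum_simps [simp]:
  "carrier (dir_sum M N) = carrier M \<times> carrier N"
  "zero (dir_sum M N) = (\<zero>\<^bsub>M\<^esub>, \<zero>\<^bsub>N\<^esub>)"
  "add (dir_sum M N) (x, y) (x', y') = (x \<oplus>\<^bsub>M\<^esub> x', y \<oplus>\<^bsub>N\<^esub> y')"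
  "smult (dir_sum M N) r (x, y) = (r \<odot>\<^bsub>M\<^esub> x, r \<odot>\<^bsub>N\<^esub> y)"
  by (simp_all add: dir_sum_def)

lemma module_dir_sum:
  assumes "module R M" "module R N"
  shows "module R (dir_sum M N)"
proof -
  interpret M: module R M by fact
  interpret N: module R N by fact
  show ?thesis
  proof (rule moduleI)
    show "cring R" by (rule M.R.is_cring)
    show "abelian_group (dir_sum M N)"
    proof (rule abelian_groupI, goal_cases)
      case (6 x)
      then show ?case
        by (intro bexI[of _ "(\<ominus>\<^bsub>M\<^esub> fst x, \<ominus>\<^bsub>N\<^esub> snd x)"]) (auto simp: M.l_neg N.l_neg)
    qed (auto simp: M.a_ac N.a_ac)
  qed (auto simp: M.smult_l_distr N.smult_l_distr M.smult_r_distr N.smult_r_distr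
      M.smult_assoc1 N.smult_assoc1)
qed

lemma linear_relation_iff:
  assumes "module R M" "module R N"
  shows "linear_relation R M N \<phi> \<longleftrightarrow> \<phi> \<subseteq> carrier M \<times> carrier N \<and> (\<zero>\<^bsub>M\<^esub>, \<zero>\<^bsub>N\<^esub>) \<in> \<phi> \<and>
    (\<forall>x y x' y'. (x, y) \<in> \<phi> \<longrightarrow> (x', y') \<in> \<phi> \<longrightarrow> (x \<oplus>\<^bsub>M\<^esub> x', y \<oplus>\<^bsub>N\<^esub> y') \<in> \<phi>) \<and>
    (\<forall>r \<in> carrier R. \<forall>x y. (x, y) \<in> \<phi> \<longrightarrow> (r \<odot>\<^bsub>M\<^esub> x, r \<odot>\<^bsub>N\<^esub> y) \<in> \<phi>)"
    (is "_ \<longleftrightarrow> ?R")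
proof
  interpret D: module R "dir_sum M N" by (rule module_dir_sum[OF assms])
  {
    assume "linear_relation R M N \<phi>"
    then have s: "submodule \<phi> R (dir_sum M N)" by (simp add: linear_relation_def)
    interpret s: subgroup \<phi> "add_monoid (dir_sum M N)" using s by (rule submodule.axioms)
    have z: "(\<zero>\<^bsub>M\<^esub>, \<zero>\<^bsub>N\<^esub>) \<in> \<phi>" using s.one_closed by simp
    have a: "(x \<oplus>\<^bsub>M\<^esub> x', y \<oplus>\<^bsub>N\<^esub> y') \<in> \<phi>" if "(x, y) \<in> \<phi>" "(x', y') \<in> \<phi>" for x y x' y'
      using D.submoduleE(5)[OF s that] by simp
    have c: "(r \<odot>\<^bsub>M\<^esub> x, r \<odot>\<^bsub>N\<^esub> y) \<in> \<phi>" if "r \<in> carrier R" "(x, y) \<in> \<phi>" for r x y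
      using D.submoduleE(4)[OF s that] by simp
    show ?R using D.submoduleE(1)[OF s] z a c by simp
  }
  assume R: ?R
  show "linear_relation R M N \<phi>"
    unfolding linear_relation_def
  proof (rule D.submoduleI)
    show "\<ominus>\<^bsub>dir_sum M N\<^esub> a \<in> \<phi>" if "a \<in> \<phi>" for a
    proof -
      have "a \<in> carrier (dir_sum M N)" using R that by auto
      then have "\<ominus>\<^bsub>dir_sum M N\<^esub> a = (\<ominus>\<^bsub>R\<^esub> \<one>\<^bsub>R\<^esub>) \<odot>\<^bsub>dir_sum M N\<^esub> a"
        by (simp add: D.smult_l_minus)
      also have "\<dots> \<in> \<phi>" using R that by (cases a) auto
      finally show ?thesis .
    qed
  qed (use R in auto)
qed

theorem category_FRel: "category (FRel R :: (('a, 'b) module, ('b \<times> 'b) set) category)"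
proof
  fix X :: "('a, 'b) module" assume "X \<in> Obj (FRel R)"
  then interpret X: module R X by (simp add: FRel_def)
  show "Ident (FRel R) X \<in> Hom (FRel R) X X"
    by (auto simp: FRel_def linear_relation_iff[OF X.module_axioms X.module_axioms])
next
  fix X Y Z :: "('a, 'b) module" and f g
  assume "X \<in> Obj (FRel R)" "Y \<in> Obj (FRel R)" "Z \<in> Obj (FRel R)"
  then have m: "module R X" "module R Y" "module R Z" by (simp_all add: FRel_def)
  assume "f \<in> Hom (FRel R) X Y" "g \<in> Hom (FRel R) Y Z"
  then have f: "linear_relation R X Y f" and g: "linear_relation R Y Z g"
    by (simp_all add: FRel_def)
  note f = f[unfolded linear_relation_iff[OF m(1,2)]] and g = g[unfolded linear_relation_iff[OF m(2,3)]]
  have "linear_relation R X Z (f O g)"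
    unfolding linear_relation_iff[OF m(1,3)]
  proof (intro conjI allI ballI impI)
    show "f O g \<subseteq> carrier X \<times> carrier Z" using f g by blast
    show "(\<zero>\<^bsub>X\<^esub>, \<zero>\<^bsub>Z\<^esub>) \<in> f O g" using f g by blast
    show "(x \<oplus>\<^bsub>X\<^esub> x', z \<oplus>\<^bsub>Z\<^esub> z') \<in> f O g" if "(x, z) \<in> f O g" "(x', z') \<in> f O g" for x z x' z'
    proof -
      from that obtain y y' where "(x, y) \<in> f" "(y, z) \<in> g" "(x', y') \<in> f" "(y', z') \<in> g"
        by blast
      then have "(x \<oplus>\<^bsub>X\<^esub> x', y \<oplus>\<^bsub>Y\<^esub> y') \<in> f" "(y \<oplus>\<^bsub>Y\<^esub> y', z \<oplus>\<^bsub>Z\<^esub> z') \<in> g"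
        using f g by simp_all
      then show ?thesis by (rule relcompI)
    qed
    show "(r \<odot>\<^bsub>X\<^esub> x, r \<odot>\<^bsub>Z\<^esub> z) \<in> f O g" if "r \<in> carrier R" "(x, z) \<in> f O g" for r x z
    proof -
      from that obtain y where "(x, y) \<in> f" "(y, z) \<in> g" by blast
      then have "(r \<odot>\<^bsub>X\<^esub> x, r \<odot>\<^bsub>Y\<^esub> y) \<in> f" "(r \<odot>\<^bsub>Y\<^esub> y, r \<odot>\<^bsub>Z\<^esub> z) \<in> g"
        using f g that(1) by simp_all
      then show ?thesis by (rule relcompI)
    qed
  qed
  then show "Comp (FRel R) X Y Z g f \<in> Hom (FRel R) X Z"
    by (simp add: FRel_def)
next
  fix X Y :: "('a, 'b) module" and f
  assume "X \<in> Obj (FRel R)" "Y \<in> Obj (FRel R)" "f \<in> Hom (FRel R) X Y"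
  then have "f \<subseteq> carrier X \<times> carrier Y" by (simp add: FRel_def linear_relation_iff)
  then show "Comp (FRel R) X X Y f (Ident (FRel R) X) = f"
    "Comp (FRel R) X Y Y (Ident (FRel R) Y) f = f"
    by (auto simp: FRel_def)
qed (auto simp: FRel_def)

context category
begin

lemma End_Obj_iff: "(A, \<alpha>) \<in> Obj (End_cat C) \<longleftrightarrow> A \<in> Obj C \<and> \<alpha> \<in> Hom C A A"
  by (simp add: End_cat_def)

lemma End_Hom_iff: "\<phi> \<in> Hom (End_cat C) (A, \<alpha>) (B, \<beta>) \<longleftrightarrow>
    \<phi> \<in> Hom C A B \<and> Comp C A A B \<phi> \<alpha> = Comp C A B B \<beta> \<phi>"
  by (simp add: End_cat_def End_Hom_def)

lemma End_Comp [simp]: "Comp (End_cat C) (A, \<alpha>) (B, \<beta>) (D, \<delta>) = Comp C A B D"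
  by (simp add: End_cat_def)

lemma End_Ident [simp]: "Ident (End_cat C) (A, \<alpha>) = Ident C A"
  by (simp add: End_cat_def)

theorem category_End: "category (End_cat C)"
proof (unfold_locales, goal_cases)
  case (1 X)
  then show ?case
    by (cases X) (simp add: End_Obj_iff End_Hom_iff Ident_Hom Comp_Ident_left Comp_Ident_right)
next
  case (2 X Y Z f g)
  obtain A \<alpha> B \<beta> D \<delta> where [simp]: "X = (A, \<alpha>)" "Y = (B, \<beta>)" "Z = (D, \<delta>)"
    by (metis surj_pair)
  from 2 have o: "A \<in> Obj C" "B \<in> Obj C" "D \<in> Obj C"
    and h: "\<alpha> \<in> Hom C A A" "\<beta> \<in> Hom C B B" "\<delta> \<in> Hom C D D" "f \<in> Hom C A B" "g \<in> Hom C B D"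
    and e: "Comp C A A B f \<alpha> = Comp C A B B \<beta> f" "Comp C B B D g \<beta> = Comp C B D D \<delta> g"
    by (auto simp: End_Obj_iff End_Hom_iff)
  have "Comp C A A D (Comp C A B D g f) \<alpha> = Comp C A B D g (Comp C A A B f \<alpha>)"
    using o h by (simp add: Comp_assoc)
  also have "\<dots> = Comp C A B D (Comp C B B D g \<beta>) f"
    using o h by (simp add: e Comp_assoc)
  also have "\<dots> = Comp C A D D \<delta> (Comp C A B D g f)"
    unfolding e using o h by (simp add: Comp_assoc)
  finally show ?case using o h by (simp add: End_Hom_iff Comp_Hom)
next
  case (3 X Y f)
  then show ?case by (cases X; cases Y) (simp add: End_Obj_iff End_Hom_iff Comp_Ident_right)
next
  case (4 X Y f)
  then show ?case by (cases X; cases Y) (simp add: End_Obj_iff End_Hom_iff Comp_Ident_left)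
next
  case (5 W X Y Z f g h)
  then show ?case
    by (cases W; cases X; cases Y; cases Z) (simp add: End_Obj_iff End_Hom_iff Comp_assoc)
qed

lemma endo_pow_Hom:
  assumes "A \<in> Obj C" "\<alpha> \<in> Hom C A A"
  shows "endo_pow C A \<alpha> k \<in> Hom C A A"
  by (induction k) (simp_all add: assms Ident_Hom Comp_Hom)

lemma endo_pow_add:
  assumes "A \<in> Obj C" "\<alpha> \<in> Hom C A A"
  shows "endo_pow C A \<alpha> (m + k) = Comp C A A A (endo_pow C A \<alpha> m) (endo_pow C A \<alpha> k)"
  by (induction m) (simp_all add: assms Comp_Ident_left endo_pow_Hom Comp_assoc)

lemma endo_pow_commute:
  assumes "A \<in> Obj C" "\<alpha> \<in> Hom C A A" "B \<in> Obj C" "\<beta> \<in> Hom C B B"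
    and "\<phi> \<in> Hom (End_cat C) (A, \<alpha>) (B, \<beta>)"
  shows "Comp C A A B \<phi> (endo_pow C A \<alpha> k) = Comp C A B B (endo_pow C B \<beta> k) \<phi>"
proof -
  have \<phi>: "\<phi> \<in> Hom C A B" "Comp C A A B \<phi> \<alpha> = Comp C A B B \<beta> \<phi>"
    using assms(5) by (simp_all add: End_Hom_iff)
  show ?thesis
  proof (induction k)
    case 0
    then show ?case using assms \<phi> by (simp add: Comp_Ident_left Comp_Ident_right)
  next
    case (Suc k)
    let ?a = "endo_pow C A \<alpha> k" and ?b = "endo_pow C B \<beta> k"
    have h: "?a \<in> Hom C A A" "?b \<in> Hom C B B" using assms by (simp_all add: endo_pow_Hom)
    have "Comp C A A B \<phi> (Comp C A A A \<alpha> ?a) = Comp C A A B (Comp C A A B \<phi> \<alpha>) ?a"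
      using assms \<phi>(1) h by (simp add: Comp_assoc)
    also have "\<dots> = Comp C A B B \<beta> (Comp C A A B \<phi> ?a)"
      unfolding \<phi>(2) using assms \<phi>(1) h by (simp add: Comp_assoc)
    also have "\<dots> = Comp C A B B (Comp C B B B \<beta> ?b) \<phi>"
      unfolding Suc using assms \<phi>(1) h by (simp add: Comp_assoc)
    finally show ?case by simp
  qed
qed

lemma szym_rel_iff: "((\<phi>, n), (\<psi>, m)) \<in> szym_rel C (A, \<alpha>) (B, \<beta>) \<longleftrightarrow>
    \<phi> \<in> Hom (End_cat C) (A, \<alpha>) (B, \<beta>) \<and> \<psi> \<in> Hom (End_cat C) (A, \<alpha>) (B, \<beta>) \<and>
    (\<exists>k. Comp C A A B \<phi> (endo_pow C A \<alpha> (m + k)) = Comp C A A B \<psi> (endo_pow C A \<alpha> (n + k)))"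
  by (simp add: szym_rel_def)

lemma pow_eq_mono:
  assumes "A \<in> Obj C" "\<alpha> \<in> Hom C A A" "B \<in> Obj C" "\<phi> \<in> Hom C A B" "\<psi> \<in> Hom C A B"
    and "Comp C A A B \<phi> (endo_pow C A \<alpha> i) = Comp C A A B \<psi> (endo_pow C A \<alpha> j)"
  shows "Comp C A A B \<phi> (endo_pow C A \<alpha> (i + l)) = Comp C A A B \<psi> (endo_pow C A \<alpha> (j + l))"
  using assms by (simp add: endo_pow_add endo_pow_Hom Comp_assoc)

theorem equiv_szym_rel:
  assumes "X \<in> Obj (End_cat C)" "Y \<in> Obj (End_cat C)"
  shows "equiv (Hom (End_cat C) X Y \<times> UNIV) (szym_rel C X Y)"
proof -
  obtain A \<alpha> B \<beta> where [simp]: "X = (A, \<alpha>)" "Y = (B, \<beta>)" by (metis surj_pair)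
  have o: "A \<in> Obj C" "\<alpha> \<in> Hom C A A" "B \<in> Obj C" "\<beta> \<in> Hom C B B"
    using assms by (simp_all add: End_Obj_iff)
  show ?thesis
  proof (rule equivI)
    show "szym_rel C X Y \<subseteq> (Hom (End_cat C) X Y \<times> UNIV) \<times> (Hom (End_cat C) X Y \<times> UNIV)"
      by (auto simp: szym_rel_iff)
    show "refl_on (Hom (End_cat C) X Y \<times> UNIV) (szym_rel C X Y)"
      by (rule refl_onI) (auto simp: szym_rel_iff)
    show "sym (szym_rel C X Y)"
    proof (rule symI)
      fix p q assume "(p, q) \<in> szym_rel C X Y"
      then show "(q, p) \<in> szym_rel C X Y"
        by (cases p; cases q) (auto simp: szym_rel_iff dest: sym)
    qed
    show "trans (szym_rel C X Y)"
    proof (rule transI)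
      fix p q r assume pq: "(p, q) \<in> szym_rel C X Y" and qr: "(q, r) \<in> szym_rel C X Y"
      obtain f n g m h l where [simp]: "p = (f, n)" "q = (g, m)" "r = (h, l)" by (metis surj_pair)
      obtain k k' where H: "f \<in> Hom (End_cat C) X Y" "g \<in> Hom (End_cat C) X Y"
          "h \<in> Hom (End_cat C) X Y"
        and k: "Comp C A A B f (endo_pow C A \<alpha> (m + k)) = Comp C A A B g (endo_pow C A \<alpha> (n + k))"
        and k': "Comp C A A B g (endo_pow C A \<alpha> (l + k')) = Comp C A A B h (endo_pow C A \<alpha> (m + k'))"
        using pq qr by (auto simp: szym_rel_iff)
      have H': "f \<in> Hom C A B" "g \<in> Hom C A B" "h \<in> Hom C A B"
        using H by (simp_all add: End_Hom_iff)
      have "Comp C A A B f (endo_pow C A \<alpha> (l + (m + k + k')))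
          = Comp C A A B g (endo_pow C A \<alpha> (n + k + (l + k')))"
        using pow_eq_mono[OF o(1-3) H'(1,2) k, of "l + k'"] by (simp add: ac_simps)
      also have "\<dots> = Comp C A A B h (endo_pow C A \<alpha> (n + (m + k + k')))"
        using pow_eq_mono[OF o(1-3) H'(2,3) k', of "n + k"] by (simp add: ac_simps)
      finally show "(p, r) \<in> szym_rel C X Y" using H by (auto simp: szym_rel_iff)
    qed
  qed
qed

lemma szym_rel_Comp:
  assumes X: "X \<in> Obj (End_cat C)" and Y: "Y \<in> Obj (End_cat C)" and Z: "Z \<in> Obj (End_cat C)"
    and p: "((\<phi>, n), (\<phi>', n')) \<in> szym_rel C X Y" and q: "((\<psi>, m), (\<psi>', m')) \<in> szym_rel C Y Z"
  shows "((Comp (End_cat C) X Y Z \<psi> \<phi>, m + n), (Comp (End_cat C) X Y Z \<psi>' \<phi>', m' + n'))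
    \<in> szym_rel C X Z"
proof -
  obtain A \<alpha> B \<beta> D \<delta> where [simp]: "X = (A, \<alpha>)" "Y = (B, \<beta>)" "Z = (D, \<delta>)"
    by (metis surj_pair)
  have o: "A \<in> Obj C" "\<alpha> \<in> Hom C A A" "B \<in> Obj C" "\<beta> \<in> Hom C B B" "D \<in> Obj C" "\<delta> \<in> Hom C D D"
    using X Y Z by (simp_all add: End_Obj_iff)
  obtain k l where H: "\<phi> \<in> Hom (End_cat C) X Y" "\<phi>' \<in> Hom (End_cat C) X Y"
      "\<psi> \<in> Hom (End_cat C) Y Z" "\<psi>' \<in> Hom (End_cat C) Y Z"
    and k: "Comp C A A B \<phi> (endo_pow C A \<alpha> (n' + k)) = Comp C A A B \<phi>' (endo_pow C A \<alpha> (n + k))"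
    and l: "Comp C B B D \<psi> (endo_pow C B \<beta> (m' + l)) = Comp C B B D \<psi>' (endo_pow C B \<beta> (m + l))"
    using p q by (auto simp: szym_rel_iff)
  have H': "\<phi> \<in> Hom C A B" "\<phi>' \<in> Hom C A B" "\<psi> \<in> Hom C B D" "\<psi>' \<in> Hom C B D"
    using H by (simp_all add: End_Hom_iff)
  have *: "Comp C A A D (Comp C A B D g f) (endo_pow C A \<alpha> (i + j))
      = Comp C A B D (Comp C B B D g (endo_pow C B \<beta> i)) (Comp C A A B f (endo_pow C A \<alpha> j))"
    if f: "f \<in> Hom (End_cat C) X Y" and g: "g \<in> Hom C B D" for f g i j
  proof -
    have f': "f \<in> Hom C A B" using f by (simp add: End_Hom_iff)
    let ?i = "endo_pow C A \<alpha> i" and ?j = "endo_pow C A \<alpha> j" and ?b = "endo_pow C B \<beta> i"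
    note h = endo_pow_Hom[OF o(1,2)] endo_pow_Hom[OF o(3,4)] f' g o
    have "Comp C A A D (Comp C A B D g f) (Comp C A A A ?i ?j)
        = Comp C A B D g (Comp C A A B (Comp C A A B f ?i) ?j)"
      using h by (simp add: Comp_assoc[symmetric] Comp_Hom)
    also have "Comp C A A B f ?i = Comp C A B B ?b f"
      using endo_pow_commute[OF o(1-4)] f by simp
    also have "Comp C A B D g (Comp C A A B (Comp C A B B ?b f) ?j)
        = Comp C A B D (Comp C B B D g ?b) (Comp C A A B f ?j)"
      using h by (simp add: Comp_assoc[symmetric] Comp_Hom)
    finally show ?thesis using o by (simp add: endo_pow_add)
  qed
  have "Comp C A A D (Comp C A B D \<psi> \<phi>) (endo_pow C A \<alpha> (m' + n' + (k + l)))
      = Comp C A A D (Comp C A B D \<psi>' \<phi>') (endo_pow C A \<alpha> (m + n + (k + l)))"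
  proof -
    have e: "m' + n' + (k + l) = (m' + l) + (n' + k)" "m + n + (k + l) = (m + l) + (n + k)"
      by simp_all
    show ?thesis unfolding e *[OF H(1) H'(3)] *[OF H(2) H'(4)] k l ..
  qed
  moreover have "Comp (End_cat C) X Y Z g f \<in> Hom (End_cat C) X Z"
    if "f \<in> Hom (End_cat C) X Y" "g \<in> Hom (End_cat C) Y Z" for f g
    using category.Comp_Hom[OF category_End X Y Z that] .
  ultimately show ?thesis using H by (auto simp: szym_rel_iff)
qed

theorem Szym_Comp_class:
  assumes X: "X \<in> Obj (End_cat C)" and Y: "Y \<in> Obj (End_cat C)" and Z: "Z \<in> Obj (End_cat C)"
    and f: "\<phi> \<in> Hom (End_cat C) X Y" and g: "\<psi> \<in> Hom (End_cat C) Y Z"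
  shows "Comp (Szym C) X Y Z (szym_class C Y Z \<psi> m) (szym_class C X Y \<phi> n)
    = szym_class C X Z (Comp (End_cat C) X Y Z \<psi> \<phi>) (m + n)"
proof -
  let ?G = "szym_class C Y Z \<psi> m" and ?F = "szym_class C X Y \<phi> n"
    and ?K = "szym_class C X Z (Comp (End_cat C) X Y Z \<psi> \<phi>) (m + n)"
  have *: "szym_class C X Z (Comp (End_cat C) X Y Z (fst q) (fst p)) (snd q + snd p) = ?K"
    if "p \<in> ?F" "q \<in> ?G" for p q
  proof -
    have "((\<phi>, n), (fst p, snd p)) \<in> szym_rel C X Y" "((\<psi>, m), (fst q, snd q)) \<in> szym_rel C Y Z"
      using that by (simp_all add: szym_class_def)
    from equiv_class_eq[OF equiv_szym_rel[OF X Z] szym_rel_Comp[OF X Y Z this]]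
    show ?thesis unfolding szym_class_def ..
  qed
  have ne: "(\<phi>, n) \<in> ?F" "(\<psi>, m) \<in> ?G"
    using f g equiv_class_self[OF equiv_szym_rel[OF X Y]] equiv_class_self[OF equiv_szym_rel[OF Y Z]]
    by (simp_all add: szym_class_def)
  have "Comp (Szym C) X Y Z ?G ?F = (\<Union>q \<in> ?G. \<Union>p \<in> ?F.
      szym_class C X Z (Comp (End_cat C) X Y Z (fst q) (fst p)) (snd q + snd p))"
    by (simp add: Szym_def case_prod_unfold)
  also have "\<dots> = (\<Union>q \<in> ?G. \<Union>p \<in> ?F. ?K)"
    by (intro SUP_cong refl *)
  also have "\<dots> = ?K" using ne by blast
  finally show ?thesis .
qed

lemma Szym_HomE:
  assumes "F \<in> Hom (Szym C) X Y"
  obtains \<phi> n where "\<phi> \<in> Hom (End_cat C) X Y" "F = szym_class C X Y \<phi> n"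
  using assms by (auto simp: Szym_def szym_class_def elim!: quotientE)

lemma szym_class_Hom: "\<phi> \<in> Hom (End_cat C) X Y \<Longrightarrow> szym_class C X Y \<phi> n \<in> Hom (Szym C) X Y"
  by (simp add: Szym_def szym_class_def quotientI)

theorem category_Szym: "category (Szym C)"
proof -
  interpret E: category "End_cat C" by (rule category_End)
  have O: "Obj (Szym C) = Obj (End_cat C)"
    and I: "\<And>X. Ident (Szym C) X = szym_class C X X (Ident (End_cat C) X) 0"
    by (simp_all add: Szym_def)
  show ?thesis
  proof (unfold_locales, goal_cases)
    case (1 X)
    then show ?case by (simp add: O I E.Ident_Hom szym_class_Hom)
  next
    case (2 X Y Z f g)
    then show ?case
      by (elim Szym_HomE) (simp add: O Szym_Comp_class szym_class_Hom E.Comp_Hom)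
  next
    case (3 X Y f)
    then show ?case
      by (elim Szym_HomE) (simp add: O I Szym_Comp_class E.Ident_Hom E.Comp_Ident_right)
  next
    case (4 X Y f)
    then show ?case
      by (elim Szym_HomE) (simp add: O I Szym_Comp_class E.Ident_Hom E.Comp_Ident_left)
  next
    case (5 W X Y Z f g h)
    then show ?case
      by (elim Szym_HomE) (simp add: O Szym_Comp_class E.Comp_Hom E.Comp_assoc add.assoc)
  qed
qed

end

end

theory Submission
  imports Defs
begin

text \<open>
  The statement holds over every category: if \<open>\<alpha>\<close> and \<open>\<beta>\<close> are isomorphisms, then a
  Szymczak isomorphism \<open>[\<phi>, n]\<close> from \<open>(A, \<alpha>)\<close> to \<open>(B, \<beta>)\<close> with inverse \<open>[\<psi>, m]\<close> has an
  underlying \<open>\<phi>\<close> that is already an isomorphism. Indeed the two identities in the Szymczak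
  category say that \<open>\<psi> \<circ> \<phi> \<circ> \<alpha>^k = \<alpha>^(m + n + k)\<close> and \<open>\<phi> \<circ> \<psi> \<circ> \<beta>^l = \<beta>^(n + m + l)\<close> for some \<open>k\<close> and \<open>l\<close>.
  The left side of the first is \<open>\<psi> \<circ> \<beta>^k \<circ> \<phi>\<close>, because \<open>\<phi>\<close> intertwines \<open>\<alpha>\<close> and \<open>\<beta>\<close>. Powers of
  \<open>\<alpha>\<close> and \<open>\<beta>\<close> being invertible, \<open>\<phi>\<close> has a left inverse by the first identity and a right
  inverse by the second. Hence \<open>\<phi>\<close> is invertible, and the inverse of an intertwining
  isomorphism intertwines \<open>\<beta>\<close> and \<open>\<alpha>\<close> (\<open>isomorphic_End_if_isomorphic_Szym\<close>).

  A bijection in the sense of linear relations is an isomorphism of the category of relations: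
  its inverse is the converse relation (\<open>iso_in_FRel_if_bijection_rel\<close>).
\<close>

definition iso_in :: "('o, 'm) category \<Rightarrow> 'o \<Rightarrow> 'o \<Rightarrow> 'm \<Rightarrow> bool" where
  "iso_in C X Y f \<longleftrightarrow> f \<in> Hom C X Y \<and>
     (\<exists>g \<in> Hom C Y X. Comp C X Y X g f = Ident C X \<and> Comp C Y X Y f g = Ident C Y)"

context category
begin

lemma iso_in_if_left_right_inverse:
  assumes o: "X \<in> Obj C" "Y \<in> Obj C"
    and h: "f \<in> Hom C X Y" "l \<in> Hom C Y X" "r \<in> Hom C Y X"
    and l: "Comp C X Y X l f = Ident C X" and r: "Comp C Y X Y f r = Ident C Y"
  shows "iso_in C X Y f"
proof -
  have "l = Comp C Y Y X l (Comp C Y X Y f r)"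
    using o h by (simp add: r Comp_Ident_right)
  also have "\<dots> = Comp C Y X X (Comp C X Y X l f) r"
    using o h by (simp only: Comp_assoc)
  also have "\<dots> = r"
    using o h by (simp add: l Comp_Ident_left)
  finally show ?thesis
    using h l r by (auto simp: iso_in_def)
qed

lemma iso_in_Ident: "X \<in> Obj C \<Longrightarrow> iso_in C X X (Ident C X)"
  by (auto simp: iso_in_def Ident_Hom Comp_Ident_left)

lemma iso_in_Comp:
  assumes o: "X \<in> Obj C" "Y \<in> Obj C" "Z \<in> Obj C"
    and f: "iso_in C X Y f" and g: "iso_in C Y Z g"
  shows "iso_in C X Z (Comp C X Y Z g f)"
proof -
  obtain f' g' where h: "f \<in> Hom C X Y" "f' \<in> Hom C Y X" "g \<in> Hom C Y Z" "g' \<in> Hom C Z Y"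
    and f': "Comp C X Y X f' f = Ident C X" "Comp C Y X Y f f' = Ident C Y"
    and g': "Comp C Y Z Y g' g = Ident C Y" "Comp C Z Y Z g g' = Ident C Z"
    using f g by (auto simp: iso_in_def)
  let ?gf = "Comp C X Y Z g f" and ?fg = "Comp C Z Y X f' g'"
  have gf: "?gf \<in> Hom C X Z" "?fg \<in> Hom C Z X"
    using o h by (simp_all add: Comp_Hom)
  have "Comp C X Z X ?fg ?gf = Comp C X Y X f' (Comp C X Y Y (Comp C Y Z Y g' g) f)"
    using o h gf by (simp add: Comp_assoc[symmetric])
  also have "\<dots> = Ident C X"
    using o h by (simp add: f' g' Comp_Ident_left)
  finally have 1: "Comp C X Z X ?fg ?gf = Ident C X" .
  have "Comp C Z X Z ?gf ?fg = Comp C Z Y Z g (Comp C Z Y Y (Comp C Y X Y f f') g')"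
    using o h gf by (simp add: Comp_assoc[symmetric])
  also have "\<dots> = Ident C Z"
    using o h by (simp add: f' g' Comp_Ident_left)
  finally show ?thesis
    using 1 gf by (auto simp: iso_in_def)
qed

lemma iso_in_endo_pow:
  assumes "A \<in> Obj C" "iso_in C A A \<alpha>"
  shows "iso_in C A A (endo_pow C A \<alpha> k)"
  by (induction k) (simp_all add: assms iso_in_Ident iso_in_Comp)

text \<open>Multiplying \<open>\<phi> \<circ> \<alpha> = \<beta> \<circ> \<phi>\<close> by the inverse of \<open>\<phi>\<close> on both sides.\<close>

lemma isomorphic_End_if_iso_in:
  assumes X: "(A, \<alpha>) \<in> Obj (End_cat C)" and Y: "(B, \<beta>) \<in> Obj (End_cat C)"
    and \<phi>: "\<phi> \<in> Hom (End_cat C) (A, \<alpha>) (B, \<beta>)" and iso: "iso_in C A B \<phi>"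
  shows "isomorphic_in (End_cat C) (A, \<alpha>) (B, \<beta>)"
proof -
  have o: "A \<in> Obj C" "B \<in> Obj C" "\<alpha> \<in> Hom C A A" "\<beta> \<in> Hom C B B"
    using X Y by (simp_all add: End_Obj_iff)
  have e: "Comp C A A B \<phi> \<alpha> = Comp C A B B \<beta> \<phi>"
    using \<phi> by (simp add: End_Hom_iff)
  obtain g where h: "\<phi> \<in> Hom C A B" "g \<in> Hom C B A"
    and g: "Comp C A B A g \<phi> = Ident C A" "Comp C B A B \<phi> g = Ident C B"
    using iso by (auto simp: iso_in_def)
  have "Comp C B B A g \<beta> = Comp C B B A g (Comp C B B B \<beta> (Comp C B A B \<phi> g))"
    using o h by (simp add: g Comp_Ident_right)
  also have "\<dots> = Comp C B B A g (Comp C B A B (Comp C A A B \<phi> \<alpha>) g)"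
    unfolding e using o h by (simp add: Comp_assoc)
  also have "\<dots> = Comp C B A A (Comp C A B A g \<phi>) (Comp C B A A \<alpha> g)"
    using o h by (simp add: Comp_assoc Comp_Hom)
  also have "\<dots> = Comp C B A A \<alpha> g"
    using o h by (simp add: g Comp_Ident_left Comp_Hom)
  finally have "g \<in> Hom (End_cat C) (B, \<beta>) (A, \<alpha>)"
    using h by (simp add: End_Hom_iff)
  then show ?thesis
    using X Y \<phi> g by (auto simp: isomorphic_in_def)
qed

text \<open>
  Equality of classes in \<open>Szym\<close> is \<open>szym_rel\<close> between the representatives; comparing with
  \<open>(id, 0)\<close> turns the exponents of that relation into \<open>k\<close> and \<open>n + k\<close>.
\<close>

lemma szym_class_eq_Ident_imp_pow:
  assumes X: "(A, \<alpha>) \<in> Obj (End_cat C)"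
    and eq: "szym_class C (A, \<alpha>) (A, \<alpha>) \<chi> n = Ident (Szym C) (A, \<alpha>)"
  obtains k where "Comp C A A A \<chi> (endo_pow C A \<alpha> k) = endo_pow C A \<alpha> (n + k)"
proof -
  have o: "A \<in> Obj C" "\<alpha> \<in> Hom C A A"
    using X by (simp_all add: End_Obj_iff)
  have "Ident C A \<in> Hom (End_cat C) (A, \<alpha>) (A, \<alpha>)"
    using o by (simp add: End_Hom_iff Ident_Hom Comp_Ident_left Comp_Ident_right)
  then have "((\<chi>, n), (Ident C A, 0)) \<in> szym_rel C (A, \<alpha>) (A, \<alpha>)"
    using eq eq_equiv_class[OF _ equiv_szym_rel[OF X X]]
    by (simp add: Szym_def szym_class_def)
  then show thesis
    using that o by (auto simp: szym_rel_iff Comp_Ident_left endo_pow_Hom)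
qed

theorem isomorphic_End_if_isomorphic_Szym:
  assumes X: "(A, \<alpha>) \<in> Obj (End_cat C)" and Y: "(B, \<beta>) \<in> Obj (End_cat C)"
    and iso: "iso_in C A A \<alpha>" "iso_in C B B \<beta>"
    and szym: "isomorphic_in (Szym C) (A, \<alpha>) (B, \<beta>)"
  shows "isomorphic_in (End_cat C) (A, \<alpha>) (B, \<beta>)"
proof -
  let ?X = "(A, \<alpha>)" and ?Y = "(B, \<beta>)"
  have o: "A \<in> Obj C" "B \<in> Obj C" "\<alpha> \<in> Hom C A A" "\<beta> \<in> Hom C B B"
    using X Y by (simp_all add: End_Obj_iff)
  obtain F G where FG: "F \<in> Hom (Szym C) ?X ?Y" "G \<in> Hom (Szym C) ?Y ?X"
    "Comp (Szym C) ?X ?Y ?X G F = Ident (Szym C) ?X"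
    "Comp (Szym C) ?Y ?X ?Y F G = Ident (Szym C) ?Y"
    using szym by (auto simp: isomorphic_in_def)
  obtain \<phi> n where \<phi>: "\<phi> \<in> Hom (End_cat C) ?X ?Y" and F: "F = szym_class C ?X ?Y \<phi> n"
    using FG(1) by (rule Szym_HomE)
  obtain \<psi> m where \<psi>: "\<psi> \<in> Hom (End_cat C) ?Y ?X" and G: "G = szym_class C ?Y ?X \<psi> m"
    using FG(2) by (rule Szym_HomE)
  have h: "\<phi> \<in> Hom C A B" "\<psi> \<in> Hom C B A"
    using \<phi> \<psi> by (simp_all add: End_Hom_iff)
  let ?a = "endo_pow C A \<alpha>" and ?b = "endo_pow C B \<beta>"
  have p: "?a i \<in> Hom C A A" "?b i \<in> Hom C B B" for i
    using o by (simp_all add: endo_pow_Hom)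
  obtain k where k: "Comp C A A A (Comp C A B A \<psi> \<phi>) (?a k) = ?a (m + n + k)"
    using szym_class_eq_Ident_imp_pow[OF X] FG(3) Szym_Comp_class[OF X Y X \<phi> \<psi>]
    by (metis F G End_Comp)
  obtain l where l: "Comp C B B B (Comp C B A B \<phi> \<psi>) (?b l) = ?b (n + m + l)"
    using szym_class_eq_Ident_imp_pow[OF Y] FG(4) Szym_Comp_class[OF Y X Y \<psi> \<phi>]
    by (metis F G End_Comp)
  obtain a' where a': "a' \<in> Hom C A A" "Comp C A A A a' (?a (m + n + k)) = Ident C A"
    using iso_in_endo_pow[OF o(1) iso(1)] by (auto simp: iso_in_def)
  obtain b' where b': "b' \<in> Hom C B B" "Comp C B B B (?b (n + m + l)) b' = Ident C B"
    using iso_in_endo_pow[OF o(2) iso(2)] by (auto simp: iso_in_def)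
  have "Comp C A B A (Comp C B A A a' (Comp C B B A \<psi> (?b k))) \<phi>
      = Comp C A A A a' (Comp C A B A \<psi> (Comp C A B B (?b k) \<phi>))"
    using o h p a' by (simp add: Comp_assoc Comp_Hom)
  also have "\<dots> = Comp C A A A a' (Comp C A B A \<psi> (Comp C A A B \<phi> (?a k)))"
    using endo_pow_commute[OF o(1,3,2,4) \<phi>] by simp
  also have "\<dots> = Comp C A A A a' (?a (m + n + k))"
    unfolding k[symmetric] using o h p by (simp add: Comp_assoc)
  finally have left:
    "Comp C A B A (Comp C B A A a' (Comp C B B A \<psi> (?b k))) \<phi> = Ident C A"
    using a'(2) by simp
  have "Comp C B A B \<phi> (Comp C B B A (Comp C B B A \<psi> (?b l)) b')
      = Comp C B B B (?b (n + m + l)) b'"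
    unfolding l[symmetric] using o h p b' by (simp add: Comp_assoc Comp_Hom)
  then have right: "Comp C B A B \<phi> (Comp C B B A (Comp C B B A \<psi> (?b l)) b') = Ident C B"
    using b'(2) by simp
  have "iso_in C A B \<phi>"
    using o h p a'(1) b'(1) left right
    by (intro iso_in_if_left_right_inverse[OF o(1,2) h(1)]) (simp_all add: Comp_Hom)
  with X Y \<phi> show ?thesis by (rule isomorphic_End_if_iso_in)
qed

end

text \<open>
  Unlike the inverse of a map, the converse of a linear relation is linear for formal reasons,
  as the defining conditions are symmetric in the two modules. Bijectivity then gives
  that the two composites with the converse are identities.
\<close>

lemma iso_in_FRel_if_bijection_rel:
  assumes A: "A \<in> Obj (FRel R)" and \<alpha>: "\<alpha> \<in> Hom (FRel R) A A" and bij: "bijection_rel A \<alpha>"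
  shows "iso_in (FRel R) A A \<alpha>"
proof -
  have m: "module R A"
    using A by (simp add: FRel_def)
  have "\<alpha>\<inverse> \<in> Hom (FRel R) A A"
    using \<alpha> by (auto simp: FRel_def linear_relation_iff[OF m m])
  moreover obtain f where f: "bij_betw f (carrier A) (carrier A)"
    and \<alpha>_eq: "\<alpha> = {(x, f x) | x. x \<in> carrier A}"
    using bij by (auto simp: bijection_rel_def)
  have "\<alpha> O \<alpha>\<inverse> = Id_on (carrier A)"
    using bij_betw_imp_inj_on[OF f] by (auto simp: \<alpha>_eq dest: inj_onD)
  moreover have "\<alpha>\<inverse> O \<alpha> = Id_on (carrier A)"
    using bij_betw_imp_surj_on[OF f] by (force simp: \<alpha>_eq)
  ultimately show ?thesis
    using \<alpha> by (auto simp: iso_in_def FRel_def)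
qed

theorem theorem2p3:
  fixes R :: "('a, 'r) ring_scheme"
    and A B :: "('a, 'b) module"
    and \<alpha> \<beta> :: "('b \<times> 'b) set"
  assumes "cring R"
    and "(A, \<alpha>) \<in> Obj (End_cat (FRel R))"
    and "(B, \<beta>) \<in> Obj (End_cat (FRel R))"
    and "bijection_rel A \<alpha>"
    and "bijection_rel B \<beta>"
    and "isomorphic_in (Szym (FRel R)) (A, \<alpha>) (B, \<beta>)"
  shows "isomorphic_in (End_cat (FRel R)) (A, \<alpha>) (B, \<beta>)"
proof -
  interpret category "FRel R :: (('a, 'b) module, ('b \<times> 'b) set) category"
    by (rule category_FRel)
  show ?thesis
    using assms(2-6)
    by (intro isomorphic_End_if_isomorphic_Szym iso_in_FRel_if_bijection_rel)
      (simp_all add: End_Obj_iff)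
qed

end
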